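(* Let $r,s$ be positive integers and $n=r+s$. Let $\{\theta_k\}_{k\ge1}$ be a sequence of complex $n\times n$ matrices and $\theta$ a complex $n\times n$ matrix such that $\sum_{k\ge1}\|\theta_k-\theta\|<\infty$, $\theta$ is diagonalizable, and the eigenvalues of $\theta$ are all of magnitude $1$. Let $$F:=\lim_{k\to\infty}\theta^{-k}\theta_k\theta_{k-1}\cdots\theta_2\theta_1$$ be the matrix defined by this convergent product. Let $f$ be the map below defining $(r,s)$-matrix continued fractions, and assume that for some integer $k_0\ge1$ the map $f$ is defined (hence continuous) on $\overline{\{\theta^kF:k\ge k_0\}}\cup\{\theta_k\theta_{k-1}\cdots\theta_1:k\ge k_0\}$. Then the $k$th approximant $s_k=f(\theta_k\theta_{k-1}\cdots\theta_1)$ of the associated $(r,s)$-matrix continued fraction has the asymptotic formula $$s_k\asymp f(\theta^kF).$$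
   Context: For an $n\times n$ complex matrix $D$ with $n=r+s$, let $B$ be the $s\times s$ submatrix formed from the last $s$ rows and last $s$ columns of $D$, and $A$ the $s\times r$ submatrix formed from the first $r$ entries of the last $s$ rows of $D$. Then $f(D)=B^{-1}A$, an $s\times r$ matrix, defined when $B$ is invertible. The $(r,s)$-matrix continued fraction associated with $\{\theta_k\}$ is defined by its sequence of approximants $s_k:=f(\theta_k\theta_{k-1}\cdots\theta_2\theta_1)$. Complex $s\times r$ matrices carry the metric given by the maximum absolute value of differences of corresponding entries; $\|\cdot\|$ is a fixed norm on $n\times n$ complex matrices; $s_k\asymp t_k$ means the distance between $s_k$ and $t_k$ tends to $0$; $\overline{S}$ denotes closure. *)

theory Defs
  imports "HOL-Analysis.Analysis"
begin

text \<open>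
  An \<open>n \<times> n\<close> matrix with \<open>n = r + s\<close> has type \<open>complex^('r + 's)^('r + 's)\<close>: the indices
  \<open>Inl i\<close> are the first \<open>r\<close> ones and the indices \<open>Inr i\<close> the last \<open>s\<close> ones.
  An \<open>s \<times> r\<close> matrix has type \<open>complex^'r^'s\<close>, since \<open>D $ i $ j\<close> is the entry in row \<open>i\<close>
  and column \<open>j\<close>. Index types are nonempty, so \<open>r\<close> and \<open>s\<close> are positive.
\<close>

definition mcf_B :: "complex^('r::finite + 's::finite)^('r + 's) \<Rightarrow> complex^'s^'s" where
  "mcf_B D = (\<chi> i j. D $ Inr i $ Inr j)"

definition mcf_A :: "complex^('r::finite + 's::finite)^('r + 's) \<Rightarrow> complex^'r^'s" where
  "mcf_A D = (\<chi> i j. D $ Inr i $ Inl j)"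

text \<open>The partial map \<open>f\<close> is a total function together with its domain \<open>mcf_dom\<close>.\<close>

definition mcf_dom :: "(complex^('r::finite + 's::finite)^('r + 's)) set" where
  "mcf_dom = {D. invertible (mcf_B D)}"

definition mcf_f :: "complex^('r::finite + 's::finite)^('r + 's) \<Rightarrow> complex^'r^'s" where
  "mcf_f D = matrix_inv (mcf_B D) ** mcf_A D"

text \<open>The operations \<open>*\<close> and \<open>^\<close> on type \<open>vec\<close> act componentwise, so powers with respect to
  the matrix product \<open>**\<close> need their own definition.\<close>

primrec mat_pow :: "'a::semiring_1^'n^'n \<Rightarrow> nat \<Rightarrow> 'a^'n^'n" where
  "mat_pow M 0 = mat 1"
| "mat_pow M (Suc k) = M ** mat_pow M k"

text \<open>\<open>T k ** T (k - 1) ** \<dots> ** T 1\<close>; the value \<open>T 0\<close> is never used.\<close>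

primrec mat_prod :: "(nat \<Rightarrow> 'a::semiring_1^'n^'n) \<Rightarrow> nat \<Rightarrow> 'a^'n^'n" where
  "mat_prod T 0 = mat 1"
| "mat_prod T (Suc k) = T (Suc k) ** mat_prod T k"

definition mcf_approximant ::
  "(nat \<Rightarrow> complex^('r::finite + 's::finite)^('r + 's)) \<Rightarrow> nat \<Rightarrow> complex^'r^'s" where
  "mcf_approximant T k = mcf_f (mat_prod T k)"

definition mat_eigenvalue :: "complex^'n^'n \<Rightarrow> complex \<Rightarrow> bool" where
  "mat_eigenvalue M c \<longleftrightarrow> (\<exists>v. v \<noteq> 0 \<and> M *v v = c *s v)"

definition diagonal_matrix :: "'a::zero^'n^'n \<Rightarrow> bool" where
  "diagonal_matrix M \<longleftrightarrow> (\<forall>i j. i \<noteq> j \<longrightarrow> M $ i $ j = 0)"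

definition diagonalizable_matrix :: "complex^'n^'n \<Rightarrow> bool" where
  "diagonalizable_matrix M \<longleftrightarrow>
     (\<exists>P D :: complex^'n^'n. invertible P \<and> diagonal_matrix D \<and> M = P ** D ** matrix_inv P)"

text \<open>An arbitrary norm on the complex vector space of \<open>n \<times> n\<close> matrices, not assumed to be
  submultiplicative.\<close>

definition is_matrix_norm :: "(complex^'n^'n \<Rightarrow> real) \<Rightarrow> bool" where
  "is_matrix_norm N \<longleftrightarrow>
     (\<forall>M. 0 \<le> N M) \<and>
     (\<forall>M. N M = 0 \<longleftrightarrow> M = 0) \<and>
     (\<forall>c M. N (\<chi> i j. c * M $ i $ j) = cmod c * N M) \<and>
     (\<forall>M M'. N (M + M') \<le> N M + N M')"

definition max_dist :: "complex^'r::finite^'s::finite \<Rightarrow> complex^'r^'s \<Rightarrow> real" where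
  "max_dist M M' = Max (range (\<lambda>(i, j). cmod (M $ i $ j - M' $ i $ j)))"

definition mat_asymp ::
  "(nat \<Rightarrow> complex^'r::finite^'s::finite) \<Rightarrow> (nat \<Rightarrow> complex^'r^'s) \<Rightarrow> bool" where
  "mat_asymp S T \<longleftrightarrow> (\<lambda>k. max_dist (S k) (T k)) \<longlonglongrightarrow> 0"

end

theory Submission
  imports Defs
begin

text \<open>
  Write \<open>\<Pi>\<^sub>k = T\<^sub>k \<cdots> T\<^sub>1\<close> and \<open>X\<^sub>k = \<theta>\<^sup>-\<^sup>k \<Pi>\<^sub>k\<close>. A diagonalizable matrix whose eigenvalues have modulus 1
  has bounded powers, positive and negative alike (\<open>bounded_powers\<close>). Since \<open>\<Pi>\<^sub>k = \<theta>\<^sup>k X\<^sub>k\<close>, the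
  increments of \<open>X\<close> are
  \<open>X\<^sub>k\<^sub>+\<^sub>1 - X\<^sub>k = \<theta>\<^sup>-\<^sup>(\<^sup>k\<^sup>+\<^sup>1\<^sup>) (T\<^sub>k\<^sub>+\<^sub>1 - \<theta>) \<theta>\<^sup>k X\<^sub>k\<close>,
  so that \<open>\<parallel>X\<^sub>k\<^sub>+\<^sub>1 - X\<^sub>k\<parallel> \<le> a\<^sub>k \<parallel>X\<^sub>k\<parallel>\<close> with \<open>\<Sum> a\<^sub>k < \<infinity>\<close>. By a discrete Gronwall argument \<open>X\<close> is
  bounded, hence its increments are absolutely summable and it converges
  (\<open>convergent_if_relative_increments_summable\<close>); its limit is \<open>F\<close>.

  Multiplying by the bounded sequence \<open>\<theta>\<^sup>k\<close> gives \<open>\<Pi>\<^sub>k - \<theta>\<^sup>k F = \<theta>\<^sup>k (X\<^sub>k - F) \<rightarrow> 0\<close>. The points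
  \<open>\<theta>\<^sup>k F\<close> are bounded, so the closure of their set for \<open>k \<ge> k\<^sub>0\<close> is compact; by hypothesis it lies
  in the domain of \<open>f\<close>, where \<open>f\<close> is continuous by Cramer's rule (\<open>isCont_mcf_f\<close>). Near
  a compact set of points of continuity a function does not separate asymptotic sequences
  (\<open>tendsto_dist_image_near_compact\<close>). Hence \<open>f(\<Pi>\<^sub>k) - f(\<theta>\<^sup>k F) \<rightarrow> 0\<close>.
\<close>

section \<open>Sequences in metric and normed spaces\<close>

text \<open>A sequential form of uniform continuity in which only one of the two sequences has to lie
  in the compact set: if the images stayed \<open>e\<close> apart along a subsequence, both sequences would
  cluster at a common point of \<open>K\<close>, where \<open>f\<close> is continuous.\<close>

lemma tendsto_dist_image_near_compact:
  fixes f :: "'a::metric_space \<Rightarrow> 'b::metric_space"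
  assumes K: "compact K" and f: "\<And>x. x \<in> K \<Longrightarrow> isCont f x"
    and y: "eventually (\<lambda>k::nat. y k \<in> K) sequentially"
    and xy: "(\<lambda>k. dist (x k) (y k)) \<longlonglongrightarrow> 0"
  shows "(\<lambda>k. dist (f (x k)) (f (y k))) \<longlonglongrightarrow> 0"
proof (rule ccontr)
  assume "\<not> ?thesis"
  then obtain e where e: "e > 0" and freq: "\<exists>\<^sub>F k in sequentially. \<not> dist (f (x k)) (f (y k)) < e"
    by (auto simp: tendsto_iff not_eventually)
  have "\<exists>\<^sub>F k in sequentially. \<not> dist (f (x k)) (f (y k)) < e \<and> y k \<in> K"
    using freq by (rule frequently_rev_mp) (use y in eventually_elim, simp)
  then have inf: "infinite {k. e \<le> dist (f (x k)) (f (y k)) \<and> y k \<in> K}"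
    by (simp add: frequently_cofinite[symmetric] cofinite_eq_sequentially not_less)
  obtain g :: "nat \<Rightarrow> nat" where g: "strict_mono g"
    and ge: "\<And>k. e \<le> dist (f (x (g k))) (f (y (g k)))" and gK: "\<And>k. y (g k) \<in> K"
    using infinite_enumerate[OF inf] by auto
  obtain l h where l: "l \<in> K" and h: "strict_mono h" and yl: "(\<lambda>k. y (g (h k))) \<longlonglongrightarrow> l"
    using seq_compactE[OF K[unfolded compact_eq_seq_compact_metric], of "\<lambda>k. y (g k)"] gK
    by (auto simp: comp_def)
  have "(\<lambda>k. dist (x (g (h k))) (y (g (h k)))) \<longlonglongrightarrow> 0"
    using LIMSEQ_subseq_LIMSEQ[OF xy strict_mono_o[OF g h]] by (simp add: comp_def)
  then have "(\<lambda>k. dist (x (g (h k))) (y (g (h k))) + dist (y (g (h k))) l) \<longlonglongrightarrow> 0"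
    using yl by (intro tendsto_add_zero) (simp_all add: tendsto_dist_iff[symmetric])
  then have "(\<lambda>k. dist (x (g (h k))) l) \<longlonglongrightarrow> 0"
    by (rule tendsto_0_le[where K = 1]) (simp add: dist_triangle)
  then have xl: "(\<lambda>k. x (g (h k))) \<longlonglongrightarrow> l"
    by (simp add: tendsto_dist_iff[symmetric])
  have "(\<lambda>k. dist (f (x (g (h k)))) (f (y (g (h k))))) \<longlonglongrightarrow> dist (f l) (f l)"
    by (intro tendsto_dist isCont_tendsto_compose[OF f[OF l]] xl yl)
  then show False
    using LIMSEQ_le_const[of _ "dist (f l) (f l)" e] ge e by fastforce
qed

text \<open>Discrete Gronwall inequality: each step multiplies the norm by at most \<open>1 + a\<^sub>k \<le> exp a\<^sub>k\<close>.\<close>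

lemma bounded_if_relative_increments_summable:
  fixes X :: "nat \<Rightarrow> 'a::real_normed_vector" and a :: "nat \<Rightarrow> real"
  assumes "summable a" and a: "\<And>k. 0 \<le> a k"
    and X: "\<And>k. norm (X (Suc k) - X k) \<le> a k * norm (X k)"
  shows "norm (X k) \<le> exp (suminf a) * norm (X 0)"
proof -
  have "norm (X k) \<le> exp (\<Sum>i<k. a i) * norm (X 0)"
  proof (induction k)
    case (Suc k)
    have "norm (X (Suc k)) \<le> (1 + a k) * norm (X k)"
      using X[of k] norm_triangle_sub[of "X (Suc k)" "X k"] by (simp add: algebra_simps)
    also have "\<dots> \<le> exp (a k) * norm (X k)"
      by (intro mult_right_mono) (simp_all)
    also have "\<dots> \<le> exp (a k) * (exp (\<Sum>i<k. a i) * norm (X 0))"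
      using Suc by (intro mult_left_mono) simp_all
    finally show ?case by (simp add: exp_add mult_ac)
  qed simp
  also have "\<dots> \<le> exp (suminf a) * norm (X 0)"
    using assms(1) a by (intro mult_right_mono) (simp_all add: sum_le_suminf)
  finally show ?thesis .
qed

text \<open>Boundedness turns the relative bound on the increments into an absolute one, and up
  to its first term the sequence consists of the partial sums of its increments.\<close>

lemma convergent_if_relative_increments_summable:
  fixes X :: "nat \<Rightarrow> 'a::banach" and a :: "nat \<Rightarrow> real"
  assumes "summable a" and "\<And>k. 0 \<le> a k"
    and X: "\<And>k. norm (X (Suc k) - X k) \<le> a k * norm (X k)"
  shows "convergent X"
proof -
  define C where "C = exp (suminf a) * norm (X 0)"
  have "norm (X (Suc k) - X k) \<le> a k * C" for k
    using X[of k] mult_left_mono[OF bounded_if_relative_increments_summable[OF assms] assms(2)]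
    unfolding C_def by (rule order_trans)
  then have "summable (\<lambda>k. X (Suc k) - X k)"
    by (rule summable_comparison_test'[OF summable_mult2[OF assms(1), of C], of 0])
  then have "convergent (\<lambda>n. (\<Sum>k<n. X (Suc k) - X k) + X 0)"
    by (intro convergent_add convergent_const) (simp add: summable_iff_convergent)
  then show ?thesis by (simp add: sum_lessThan_telescope)
qed

section \<open>An arbitrary matrix norm dominates the Euclidean one\<close>

text \<open>A norm on a Euclidean space is convex, hence continuous, so it has a positive minimum on the
  compact unit sphere.\<close>

lemma norm_le_mult_of_norm_axioms:
  fixes N :: "'a::euclidean_space \<Rightarrow> real"
  assumes ge0: "\<And>x. 0 \<le> N x" and eq0: "\<And>x. N x = 0 \<Longrightarrow> x = 0"
    and scale: "\<And>c x. N (c *\<^sub>R x) = \<bar>c\<bar> * N x" and tri: "\<And>x y. N (x + y) \<le> N x + N y"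
  obtains C where "C > 0" and "\<And>x. norm x \<le> C * N x"
proof -
  have "convex_on UNIV N"
  proof (rule convex_onI)
    fix t x y assume "0 < t" "t < (1::real)"
    then show "N ((1 - t) *\<^sub>R x + t *\<^sub>R y) \<le> (1 - t) * N x + t * N y"
      using tri[of "(1 - t) *\<^sub>R x" "t *\<^sub>R y"] by (simp add: scale)
  qed simp
  then have "continuous_on (sphere 0 1) N"
    using convex_on_continuous[OF open_UNIV] continuous_on_subset by blast
  moreover have "sphere (0 :: 'a) 1 \<noteq> {}"
    using SOME_Basis[where 'a = 'a] by (auto simp: dest: norm_Basis)
  ultimately obtain u where u: "norm u = 1" and min: "\<And>x. norm x = 1 \<Longrightarrow> N u \<le> N x"
    using continuous_attains_inf[OF compact_sphere] by (metis mem_sphere_0)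
  have Nu: "N u > 0"
    using ge0[of u] eq0[of u] u by (metis less_eq_real_def norm_zero zero_neq_one)
  have "norm x \<le> inverse (N u) * N x" for x
  proof (cases "x = 0")
    case True
    then show ?thesis using ge0[of x] Nu by simp
  next
    case False
    then have "N u \<le> N (inverse (norm x) *\<^sub>R x)" by (intro min) simp
    with False Nu show ?thesis by (simp add: scale field_simps)
  qed
  with Nu show ?thesis by (intro that[of "inverse (N u)"]) simp_all
qed

lemma norm_le_mult_matrix_norm:
  assumes "is_matrix_norm N"
  obtains C where "C > 0" and "\<And>M. norm M \<le> C * N M"
proof (rule norm_le_mult_of_norm_axioms[of N])
  fix c :: real and M :: "complex^'a^'a"
  have "c *\<^sub>R M = (\<chi> i j. complex_of_real c * M $ i $ j)"
    by (simp add: vec_eq_iff scaleR_conv_of_real[where 'a = complex])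
  then show "N (c *\<^sub>R M) = \<bar>c\<bar> * N M"
    using assms unfolding is_matrix_norm_def by (metis norm_of_real)
qed (use assms that in \<open>auto simp: is_matrix_norm_def\<close>)

section \<open>Powers of matrices with unimodular spectrum\<close>

lemma bounded_bilinear_matrix_mult:
  "bounded_bilinear ((**) :: complex^'m^'l \<Rightarrow> complex^'n^'m \<Rightarrow> complex^'n^'l)"
proof -
  have "(A + B) ** C = A ** C + B ** C" for A B :: "complex^'m^'l" and C :: "complex^'n^'m"
    by (simp add: vec_eq_iff matrix_matrix_mult_def distrib_right sum.distrib)
  then show ?thesis
    unfolding bilinear_conv_bounded_bilinear[symmetric] bilinear_def
    by (auto intro!: linearI simp: matrix_add_ldistrib scalar_matrix_assoc matrix_scalar_ac)
qed

lemma mat_pow_Suc_right: "mat_pow M (Suc k) = mat_pow M k ** M"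
  by (induction k) (simp_all add: matrix_mul_assoc)

lemma mat_pow_mult_inverse:
  assumes "M ** M' = mat 1"
  shows "mat_pow M k ** mat_pow M' k = mat 1"
proof (induction k)
  case (Suc k)
  have "mat_pow M (Suc k) ** mat_pow M' (Suc k)
      = mat_pow M k ** (M ** M') ** mat_pow M' k"
    by (simp only: mat_pow_Suc_right[of M k] mat_pow.simps(2)[of M' k] matrix_mul_assoc)
  with Suc assms show ?case by simp
qed simp

lemma matrix_inv_right_left:
  assumes "invertible M"
  shows matrix_inv_right: "M ** matrix_inv M = mat 1"
    and matrix_inv_left: "matrix_inv M ** M = mat 1"
  using someI_ex[OF assms[unfolded invertible_def]] by (simp_all add: matrix_inv_def)

lemma mat_pow_conjugate:
  assumes "Q ** P = mat 1" and "P ** Q = mat 1"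
  shows "mat_pow (P ** D ** Q) k = P ** mat_pow D k ** Q"
proof (induction k)
  case (Suc k)
  have "mat_pow (P ** D ** Q) (Suc k) = P ** D ** (Q ** P) ** mat_pow D k ** Q"
    by (simp only: Suc mat_pow.simps matrix_mul_assoc)
  with assms show ?case by (simp add: matrix_mul_assoc)
qed (simp add: assms)

definition diag :: "('n \<Rightarrow> 'a::zero) \<Rightarrow> 'a^'n^'n" where
  "diag d = (\<chi> i j. if i = j then d i else 0)"

lemma diag_mult: "diag a ** diag b = diag (\<lambda>i. a i * b i :: 'a::semiring_1)"
  by (auto simp: diag_def matrix_matrix_mult_def vec_eq_iff if_distrib[of "\<lambda>x. x * _"]
      if_distrib[of "\<lambda>x. _ * x"] sum.delta cong: if_cong)

lemma mat_pow_diag: "mat_pow (diag d) k = diag (\<lambda>i. d i ^ k)"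
  by (induction k) (simp_all add: diag_mult, simp add: diag_def mat_def)

lemma norm_diag_le:
  fixes d :: "'n::finite \<Rightarrow> complex"
  assumes "\<And>i. cmod (d i) = 1"
  shows "norm (diag d) \<le> real CARD('n)"
proof -
  have "norm (diag d $ i) = 1" for i
  proof -
    have "diag d $ i = axis i (d i)"
      by (auto simp: diag_def axis_def vec_eq_iff)
    then show ?thesis using assms
      by (simp add: norm_vec_def axis_def L2_set_def if_distrib[of "\<lambda>x. (norm x)\<^sup>2"]
          cong: if_cong)
  qed
  then show ?thesis
    using L2_set_le_sum[of UNIV "\<lambda>i. norm (diag d $ i)"] by (simp add: norm_vec_def)
qed

text \<open>The columns of the change of basis \<open>P\<close> are eigenvectors of \<open>\<theta>\<close>, so the diagonal entries
  are eigenvalues.\<close>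

lemma diagonalizable_unimodular:
  fixes \<theta> :: "complex^'n^'n"
  assumes "diagonalizable_matrix \<theta>" and "\<And>c. mat_eigenvalue \<theta> c \<Longrightarrow> cmod c = 1"
  obtains P Q :: "complex^'n^'n" and d where "P ** Q = mat 1" "Q ** P = mat 1" "\<theta> = P ** diag d ** Q"
    "\<And>i. cmod (d i) = 1"
proof -
  obtain P D :: "complex^'n^'n" where P: "invertible P" and D: "diagonal_matrix D"
    and \<theta>: "\<theta> = P ** D ** matrix_inv P"
    using assms(1) unfolding diagonalizable_matrix_def by blast
  define Q where "Q = matrix_inv P"
  have PQ: "P ** Q = mat 1" "Q ** P = mat 1"
    using matrix_inv_right_left[OF P] by (simp_all add: Q_def)
  define d where "d i = D $ i $ i" for i
  have Dd: "D = diag d"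
    using D by (auto simp: diagonal_matrix_def diag_def d_def vec_eq_iff)
  have "cmod (d i) = 1" for i
  proof (rule assms(2), unfold mat_eigenvalue_def, intro exI conjI)
    let ?e = "axis i 1 :: complex^'n"
    have "Q *v (P *v ?e) = ?e"
      by (simp add: matrix_vector_mul_assoc PQ)
    then show "P *v ?e \<noteq> 0" by auto
    have De: "diag d *v ?e = d i *s ?e"
      by (auto simp: diag_def axis_def matrix_vector_mult_def vec_eq_iff
          if_distrib[of "\<lambda>x. _ * x"] cong: if_cong)
    have "\<theta> *v (P *v ?e) = P *v (diag d *v (Q ** P *v ?e))"
      by (simp only: \<theta> Dd Q_def matrix_vector_mul_assoc matrix_mul_assoc)
    also have "\<dots> = d i *s (P *v ?e)"
      by (simp add: PQ De vec.scale)
    finally show "\<theta> *v (P *v ?e) = d i *s (P *v ?e)" .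
  qed
  with PQ \<theta> Dd show ?thesis by (intro that[of P Q d]) (simp_all add: Q_def)
qed

text \<open>In the eigenbasis both \<open>\<theta>\<^sup>k\<close> and \<open>\<theta>\<^sup>-\<^sup>k\<close> are diagonal with unimodular entries,
  which bounds their norms; the change of basis does not depend on \<open>k\<close>.\<close>

lemma bounded_powers:
  fixes \<theta> :: "complex^'n^'n"
  assumes "diagonalizable_matrix \<theta>" and "\<And>c. mat_eigenvalue \<theta> c \<Longrightarrow> cmod c = 1"
  shows "invertible \<theta>"
    and "\<exists>K. \<forall>k. norm (mat_pow \<theta> k) \<le> K \<and> norm (mat_pow (matrix_inv \<theta>) k) \<le> K"
proof -
  obtain P Q :: "complex^'n^'n" and d where PQ: "P ** Q = mat 1" "Q ** P = mat 1" and \<theta>: "\<theta> = P ** diag d ** Q"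
    and d: "\<And>i. cmod (d i) = 1"
    using diagonalizable_unimodular[OF assms] by blast
  have [simp]: "d i \<noteq> 0" for i using d[of i] by auto
  define \<theta>' where "\<theta>' = P ** diag (\<lambda>i. inverse (d i)) ** Q"
  have "\<theta> ** \<theta>' = P ** diag d ** (Q ** P) ** diag (\<lambda>i. inverse (d i)) ** Q"
    by (simp only: \<theta> \<theta>'_def matrix_mul_assoc)
  also have "\<dots> = P ** (diag d ** diag (\<lambda>i. inverse (d i))) ** Q"
    by (simp only: PQ matrix_mul_rid matrix_mul_assoc)
  also have "diag d ** diag (\<lambda>i. inverse (d i)) = mat 1"
    by (simp add: diag_mult) (simp add: diag_def mat_def)
  finally have \<theta>\<theta>': "\<theta> ** \<theta>' = mat 1"
    by (simp add: PQ)
  then show inv: "invertible \<theta>"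
    by (auto simp: invertible_right_inverse)
  have "matrix_inv \<theta> = matrix_inv \<theta> ** (\<theta> ** \<theta>')"
    by (simp add: \<theta>\<theta>')
  also have "\<dots> = \<theta>'"
    by (simp add: matrix_mul_assoc matrix_inv_left[OF inv])
  finally have inv_eq: "matrix_inv \<theta> = \<theta>'" .
  interpret mult: bounded_bilinear "(**) :: complex^'n^'n \<Rightarrow> complex^'n^'n \<Rightarrow> _"
    by (rule bounded_bilinear_matrix_mult)
  obtain B where B: "B \<ge> 0" "\<And>(X :: complex^'n^'n) (Y :: complex^'n^'n). norm (X ** Y) \<le> norm X * norm Y * B"
    using mult.nonneg_bounded by blast
  have bound: "norm (mat_pow (P ** diag c ** Q) k) \<le> norm P * CARD('n) * B * norm Q * B"
    if "\<And>i. cmod (c i) = 1" for c k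
  proof -
    have "norm (P ** diag (\<lambda>i. c i ^ k) ** Q) \<le> norm (P ** diag (\<lambda>i. c i ^ k)) * norm Q * B"
      by (rule B)
    also have "\<dots> \<le> (norm P * norm (diag (\<lambda>i. c i ^ k)) * B) * norm Q * B"
      using B by (intro mult_right_mono) auto
    also have "\<dots> \<le> (norm P * CARD('n) * B) * norm Q * B"
      using B norm_diag_le[of "\<lambda>i. c i ^ k"] that
      by (intro mult_right_mono mult_left_mono) (auto simp: norm_power)
    finally show ?thesis by (simp add: mat_pow_conjugate PQ mat_pow_diag)
  qed
  show "\<exists>K. \<forall>k. norm (mat_pow \<theta> k) \<le> K \<and> norm (mat_pow (matrix_inv \<theta>) k) \<le> K"
    using bound[of d] bound[of "\<lambda>i. inverse (d i)"]
    by (auto simp: \<theta>[symmetric] \<theta>'_def[symmetric] inv_eq d norm_inverse)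
qed

section \<open>Continuity of the map defining the continued fraction\<close>

lemma continuous_on_det [continuous_intros]:
  fixes M :: "'a::topological_space \<Rightarrow> complex^'n^'n"
  assumes "\<And>i j. continuous_on S (\<lambda>x. M x $ i $ j)"
  shows "continuous_on S (\<lambda>x. det (M x))"
  unfolding det_def by (intro continuous_intros assms)

text \<open>Cramer's rule, applied to each column of the right-hand side, makes the entries of
  \<open>B\<^sup>-\<^sup>1 A\<close> rational functions of the entries of \<open>A\<close> and \<open>B\<close>.\<close>

lemma matrix_inv_mult_cramer:
  fixes B :: "'a::field^'n^'n" and A :: "'a^'m^'n"
  assumes "invertible B"
  shows "matrix_inv B ** A =
    (\<chi> i j. det (\<chi> p q. if q = i then A $ p $ j else B $ p $ q) / det B)"
proof -
  have col: "column j (matrix_inv B ** A) =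
    (\<chi> i. det (\<chi> p q. if q = i then column j A $ p else B $ p $ q) / det B)" for j
  proof (subst cramer[symmetric])
    show "det B \<noteq> 0" using assms by (simp add: invertible_det_nz)
    have "B *v column j (matrix_inv B ** A) = column j (B ** (matrix_inv B ** A))"
      by (simp add: vec_eq_iff column_def matrix_vector_mult_def matrix_matrix_mult_def)
    also have "\<dots> = column j A"
      by (simp add: matrix_mul_assoc matrix_inv_right[OF assms])
    finally show "B *v column j (matrix_inv B ** A) = column j A" .
  qed
  show ?thesis
    using col by (simp add: vec_eq_iff column_def cong: if_cong)
qed

lemma open_mcf_dom: "open (mcf_dom :: (complex^('r::finite + 's::finite)^('r + 's)) set)"
proof -
  have "mcf_dom = {D :: complex^('r + 's)^('r + 's). det (mcf_B D) \<noteq> 0}"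
    by (simp add: mcf_dom_def invertible_det_nz)
  moreover have "open \<dots>"
    unfolding mcf_B_def by (intro open_Collect_neq continuous_intros)
  ultimately show ?thesis by simp
qed

lemma isCont_mcf_f:
  fixes D :: "complex^('r::finite + 's::finite)^('r + 's)"
  assumes "D \<in> mcf_dom"
  shows "isCont mcf_f D"
proof -
  have "continuous_on mcf_dom (\<lambda>D :: complex^('r + 's)^('r + 's).
      \<chi> i j. det (\<chi> p q. if q = i then mcf_A D $ p $ j else mcf_B D $ p $ q) / det (mcf_B D))"
  proof (intro continuous_on_vec_lambda continuous_on_divide continuous_on_det)
    fix i :: 's and j :: 'r and p q :: 's
    show "continuous_on mcf_dom (\<lambda>D :: complex^('r + 's)^('r + 's).
        (\<chi> p q. if q = i then mcf_A D $ p $ j else mcf_B D $ p $ q) $ p $ q)"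
      by (cases "q = i") (simp_all add: mcf_A_def mcf_B_def continuous_on_component)
    show "continuous_on mcf_dom (\<lambda>D :: complex^('r + 's)^('r + 's). mcf_B D $ p $ q)"
      by (simp add: mcf_B_def continuous_on_component)
  qed (auto simp: mcf_dom_def invertible_det_nz)
  then have "continuous_on mcf_dom (mcf_f :: complex^('r + 's)^('r + 's) \<Rightarrow> _)"
    by (rule continuous_on_eq) (simp add: mcf_f_def mcf_dom_def matrix_inv_mult_cramer)
  then show ?thesis
    using assms by (simp add: continuous_on_eq_continuous_at open_mcf_dom)
qed

lemma mat_asympI:
  assumes "(\<lambda>k. dist (S k) (T k)) \<longlonglongrightarrow> 0"
  shows "mat_asymp S T"
  unfolding mat_asymp_def
proof (rule tendsto_sandwich[OF _ _ tendsto_const assms])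
  have entry: "cmod (M $ i $ j - M' $ i $ j) \<le> dist M M'" for M M' :: "complex^'a^'b" and i j
    using dist_vec_nth_le[of "M $ i" j "M' $ i"] dist_vec_nth_le[of M i M']
    by (simp add: dist_norm)
  have "0 \<le> max_dist M M'" for M M' :: "complex^'a^'b"
    unfolding max_dist_def by (subst Max_ge_iff) auto
  then show "\<forall>\<^sub>F k in sequentially. 0 \<le> max_dist (S k) (T k)" by simp
  have "max_dist M M' \<le> dist M M'" for M M' :: "complex^'a^'b"
    unfolding max_dist_def by (subst Max_le_iff) (auto simp: entry)
  then show "\<forall>\<^sub>F k in sequentially. max_dist (S k) (T k) \<le> dist (S k) (T k)" by simp
qed

section \<open>Asymptotics of the approximants\<close>

text \<open>Since \<open>T\<^sub>k\<^sub>+\<^sub>1\<close> is surrounded by powers of \<open>\<theta>\<^sup>-\<^sup>1\<close> and \<open>\<theta>\<close>, each increment of the normalized product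
  is its current value multiplied by matrices of bounded norm and by \<open>T\<^sub>k\<^sub>+\<^sub>1 - \<theta>\<close>, whose norms are
  summable.\<close>

lemma convergent_normalized_product:
  fixes T :: "nat \<Rightarrow> complex^'n^'n" and \<theta> :: "complex^'n^'n"
  assumes inv: "\<theta> ** \<theta>' = mat 1"
    and bdd: "\<And>k. norm (mat_pow \<theta> k) \<le> K" "\<And>k. norm (mat_pow \<theta>' k) \<le> K"
    and sum: "summable (\<lambda>k. norm (T (Suc k) - \<theta>))"
  shows "convergent (\<lambda>k. mat_pow \<theta>' k ** mat_prod T k)"
proof -
  define X where "X k = mat_pow \<theta>' k ** mat_prod T k" for k
  have inv': "\<theta>' ** \<theta> = mat 1"
    using inv by (simp add: matrix_left_right_inverse)
  interpret mult: bounded_bilinear "(**) :: complex^'n^'n \<Rightarrow> complex^'n^'n \<Rightarrow> _"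
    by (rule bounded_bilinear_matrix_mult)
  obtain B where B: "B \<ge> 0" "\<And>(X :: complex^'n^'n) (Y :: complex^'n^'n). norm (X ** Y) \<le> norm X * norm Y * B"
    using mult.nonneg_bounded by blast
  have K: "K \<ge> 0" using bdd(1)[of 0] norm_ge_zero order_trans by blast
  have incr: "X (Suc k) - X k = mat_pow \<theta>' (Suc k) ** (T (Suc k) - \<theta>) ** (mat_pow \<theta> k ** X k)"
    for k
  proof -
    have "mat_prod T k = mat_pow \<theta> k ** X k"
      by (simp add: X_def matrix_mul_assoc mat_pow_mult_inverse[OF inv])
    moreover have "mat_pow \<theta>' (Suc k) ** \<theta> = mat_pow \<theta>' k"
      by (simp add: mat_pow_Suc_right inv' matrix_mul_assoc[symmetric] del: mat_pow.simps)
    ultimately show ?thesis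
      by (simp add: X_def mult.diff_left mult.diff_right matrix_mul_assoc del: mat_pow.simps)
  qed
  have "norm (X (Suc k) - X k) \<le> norm (T (Suc k) - \<theta>) * (K * K * B * B * B) * norm (X k)" for k
  proof -
    have "norm (X (Suc k) - X k)
        \<le> norm (mat_pow \<theta>' (Suc k) ** (T (Suc k) - \<theta>)) * norm (mat_pow \<theta> k ** X k) * B"
      unfolding incr by (rule B)
    also have "\<dots> \<le> (K * norm (T (Suc k) - \<theta>) * B) * (K * norm (X k) * B) * B"
    proof (intro mult_right_mono mult_mono)
      show "norm (mat_pow \<theta>' (Suc k) ** (T (Suc k) - \<theta>)) \<le> K * norm (T (Suc k) - \<theta>) * B"
        by (rule order_trans[OF B(2)]) (intro mult_right_mono bdd B norm_ge_zero)
      show "norm (mat_pow \<theta> k ** X k) \<le> K * norm (X k) * B"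
        by (rule order_trans[OF B(2)]) (intro mult_right_mono bdd B norm_ge_zero)
    qed (use B K in auto)
    finally show ?thesis by (simp add: mult_ac)
  qed
  then have "convergent X"
    using B K sum by (intro convergent_if_relative_increments_summable
        [where a = "\<lambda>k. norm (T (Suc k) - \<theta>) * (K * K * B * B * B)"] summable_mult2) auto
  then show ?thesis unfolding X_def .
qed

theorem theorem11:
  fixes nrm :: "complex^('r::finite + 's::finite)^('r + 's) \<Rightarrow> real"
    and T :: "nat \<Rightarrow> complex^('r + 's)^('r + 's)"
    and \<theta> F :: "complex^('r + 's)^('r + 's)"
  assumes "is_matrix_norm nrm"
    and "summable (\<lambda>k. nrm (T (Suc k) - \<theta>))"
    and "diagonalizable_matrix \<theta>"
    and "\<forall>c. mat_eigenvalue \<theta> c \<longrightarrow> cmod c = 1"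
    and "F = lim (\<lambda>k. mat_pow (matrix_inv \<theta>) k ** mat_prod T k)"
  shows "(\<lambda>k. mat_pow (matrix_inv \<theta>) k ** mat_prod T k) \<longlonglongrightarrow> F \<and>
    (\<forall>k0\<ge>1.
       closure {mat_pow \<theta> k ** F | k. k \<ge> k0} \<union> {mat_prod T k | k. k \<ge> k0} \<subseteq> mcf_dom \<longrightarrow>
       mat_asymp (mcf_approximant T) (\<lambda>k. mcf_f (mat_pow \<theta> k ** F)))"
proof -
  let ?X = "\<lambda>k. mat_pow (matrix_inv \<theta>) k ** mat_prod T k"
  obtain C where C: "\<And>M. norm M \<le> C * nrm M"
    using norm_le_mult_matrix_norm[OF assms(1)] by blast
  have sum: "summable (\<lambda>k. norm (T (Suc k) - \<theta>))"
    by (rule summable_comparison_test'[OF summable_mult[OF assms(2), of C], of 0]) (simp add: C)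
  have inv: "\<theta> ** matrix_inv \<theta> = mat 1"
    using bounded_powers(1)[OF assms(3)] assms(4) by (blast intro: matrix_inv_right)
  obtain K where K: "\<And>k. norm (mat_pow \<theta> k) \<le> K" "\<And>k. norm (mat_pow (matrix_inv \<theta>) k) \<le> K"
    using bounded_powers(2)[OF assms(3)] assms(4) by blast
  have lim: "?X \<longlonglongrightarrow> F"
    using convergent_normalized_product[OF inv K sum] assms(5) by (simp add: convergent_LIMSEQ_iff)
  interpret mult: bounded_bilinear
    "(**) :: complex^('r + 's)^('r + 's) \<Rightarrow> complex^('r + 's)^('r + 's) \<Rightarrow> _"
    by (rule bounded_bilinear_matrix_mult)
  obtain B where B: "B \<ge> 0"
    "\<And>(X :: complex^('r + 's)^('r + 's)) (Y :: complex^('r + 's)^('r + 's)). norm (X ** Y) \<le> norm X * norm Y * B"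
    using mult.nonneg_bounded by blast
  have powbd: "norm (mat_pow \<theta> k ** Y) \<le> K * norm Y * B" for k and Y :: "complex^('r + 's)^('r + 's)"
    by (rule order_trans[OF B(2)]) (intro mult_right_mono K B norm_ge_zero)
  have "(\<lambda>k. K * norm (?X k - F) * B) \<longlonglongrightarrow> K * norm (F - F) * B"
    by (intro tendsto_intros lim)
  then have bound0: "(\<lambda>k. K * norm (?X k - F) * B) \<longlonglongrightarrow> 0" by simp
  have "dist (mat_prod T k) (mat_pow \<theta> k ** F) \<le> K * norm (?X k - F) * B" for k
  proof -
    have "mat_prod T k - mat_pow \<theta> k ** F = mat_pow \<theta> k ** (?X k - F)"
      by (simp add: mult.diff_right matrix_mul_assoc mat_pow_mult_inverse[OF inv])
    then show ?thesis using powbd by (simp add: dist_norm)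
  qed
  then have close: "(\<lambda>k. dist (mat_prod T k) (mat_pow \<theta> k ** F)) \<longlonglongrightarrow> 0"
    by (intro tendsto_sandwich[OF _ _ tendsto_const bound0]) auto
  have "mat_asymp (mcf_approximant T) (\<lambda>k. mcf_f (mat_pow \<theta> k ** F))"
    if dom: "closure {mat_pow \<theta> k ** F | k. k \<ge> k0} \<subseteq> mcf_dom" for k0
    unfolding mcf_approximant_def
  proof (rule mat_asympI, rule tendsto_dist_image_near_compact[OF _ _ _ close])
    let ?S = "{mat_pow \<theta> k ** F | k. k \<ge> k0}"
    have "bounded ?S"
      unfolding bounded_iff using powbd by blast
    then show "compact (closure ?S)" by simp
    show "isCont mcf_f D" if "D \<in> closure ?S" for D
      using isCont_mcf_f that dom by blast
    have "mat_pow \<theta> k ** F \<in> closure ?S" if "k \<ge> k0" for k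
      using that by (intro closure_subset[THEN subsetD]) auto
    then show "\<forall>\<^sub>F k in sequentially. mat_pow \<theta> k ** F \<in> closure ?S"
      by (auto simp: eventually_sequentially)
  qed
  with lim show ?thesis by auto
qed

end
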